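(* The symmetry algebra $\mathfrak g$ of the three dimensional Euler equations of gas dynamics (the 13-dimensional real Lie algebra described in the context) has the following structure: $$\mathfrak g\cong\mathbb R\times\bigl(((\mathbb R^3\ltimes\mathbb R^4)\ltimes\mathbb R^2)\ltimes\mathfrak{so}(3)\bigr).$$
   Context: The three dimensional Euler equations of gas dynamics, for unknown functions $u,v,w,p,q$ of $(t,x,y,z)$ with $\gamma\in\mathbb R$, are $$\begin{aligned} &u_t+uu_x+vu_y+wu_z+\tfrac1q p_x=0,\quad v_t+uv_x+vv_y+wv_z+\tfrac1q p_y=0,\\ &w_t+uw_x+vw_y+ww_z+\tfrac1q p_z=0,\quad q_t+q(u_x+v_y+w_z)+uq_x+vq_y+wq_z=0,\\ &p_t+\gamma p(u_x+v_y+w_z)+up_x+vp_y+wp_z=0. \end{aligned}$$ The symmetry algebra $\mathfrak g$ is the real Lie algebra of vector fields on the space with coordinates $(t,x,y,z,u,v,w,p,q)$, with bracket $[X,Y]=XY-YX$, spanned by $$\begin{aligned} X_1&=\partial_x,\quad X_2=\partial_y,\quad X_3=\partial_z,\quad X_4=\partial_t,\\ X_5&=t\,\partial_x+\partial_u,\quad X_6=t\,\partial_y+\partial_v,\quad X_7=t\,\partial_z+\partial_w,\\ X_8&=t\,\partial_t-u\,\partial_u-v\,\partial_v-w\,\partial_w+2q\,\partial_q,\\ X_9&=x\,\partial_x+y\,\partial_y+z\,\partial_z+u\,\partial_u+v\,\partial_v+w\,\partial_w-2q\,\partial_q,\\ X_{10}&=y\,\partial_x-x\,\partial_y+v\,\partial_u-u\,\partial_v,\quad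 X_{11}=-z\,\partial_y+y\,\partial_z-w\,\partial_v+v\,\partial_w,\\ X_{12}&=-z\,\partial_x+x\,\partial_z-w\,\partial_u+u\,\partial_w,\quad X_{13}=q\,\partial_q+p\,\partial_p. \end{aligned}$$ Notation: $\mathbb R^k$ denotes the $k$-dimensional Abelian Lie algebra; $\mathfrak{so}(3)=\{A\in\mathrm{Mat}(3\times3;\mathbb R)\mid A^t=-A\}$; $\times$ denotes a direct product of Lie algebras; $\mathfrak a\ltimes\mathfrak b$ denotes a semi-direct sum, written with the ideal $\mathfrak a$ on the left and the complementary subalgebra $\mathfrak b$ on the right.
   Formalization: In the innermost semi-direct sum the ideal is taken to be R^4, with R^3 the complementary subalgebra acting on it; with the stated convention (ideal R^3 on the left, abelian complement R^4) the claimed isomorphism is false. *)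

theory Defs
  imports "HOL-Analysis.Analysis" "HOL-Library.Function_Algebras"
begin

section \<open>Real Lie algebras\<close>

text \<open>A real Lie algebra is given by a linear subspace of an ambient real vector space together
  with a bracket. The values of the bracket outside the carrier are irrelevant.\<close>

record 'a lie_alg =
  lie_carrier :: "'a set"
  lie_br :: "'a \<Rightarrow> 'a \<Rightarrow> 'a"

definition lie_algebra :: "'a::real_vector lie_alg \<Rightarrow> bool" where
  "lie_algebra L \<longleftrightarrow>
     subspace (lie_carrier L) \<and>
     (\<forall>x\<in>lie_carrier L. \<forall>y\<in>lie_carrier L. lie_br L x y \<in> lie_carrier L) \<and>
     (\<forall>x\<in>lie_carrier L. \<forall>y\<in>lie_carrier L. \<forall>z\<in>lie_carrier L. \<forall>a b.
        lie_br L (a *\<^sub>R x + b *\<^sub>R y) z = a *\<^sub>R lie_br L x z + b *\<^sub>R lie_br L y z \<and>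
        lie_br L z (a *\<^sub>R x + b *\<^sub>R y) = a *\<^sub>R lie_br L z x + b *\<^sub>R lie_br L z y) \<and>
     (\<forall>x\<in>lie_carrier L. lie_br L x x = 0) \<and>
     (\<forall>x\<in>lie_carrier L. \<forall>y\<in>lie_carrier L. \<forall>z\<in>lie_carrier L.
        lie_br L x (lie_br L y z) + lie_br L y (lie_br L z x) + lie_br L z (lie_br L x y) = 0)"

definition lie_isomorphic ::
    "'a::real_vector lie_alg \<Rightarrow> 'b::real_vector lie_alg \<Rightarrow> bool" (infix "\<cong>\<^sub>L" 50) where
  "L \<cong>\<^sub>L M \<longleftrightarrow> lie_algebra L \<and> lie_algebra M \<and>
     (\<exists>\<phi>. bij_betw \<phi> (lie_carrier L) (lie_carrier M) \<and>
        (\<forall>x\<in>lie_carrier L. \<forall>y\<in>lie_carrier L. \<forall>a b.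
           \<phi> (a *\<^sub>R x + b *\<^sub>R y) = a *\<^sub>R \<phi> x + b *\<^sub>R \<phi> y) \<and>
        (\<forall>x\<in>lie_carrier L. \<forall>y\<in>lie_carrier L. \<phi> (lie_br L x y) = lie_br M (\<phi> x) (\<phi> y)))"

definition abelian_lie :: "'a::real_vector lie_alg" where
  "abelian_lie = \<lparr>lie_carrier = UNIV, lie_br = (\<lambda>_ _. 0)\<rparr>"

definition so3_lie :: "(real ^ 3 ^ 3) lie_alg" where
  "so3_lie = \<lparr>lie_carrier = {A. transpose A = - A}, lie_br = (\<lambda>A B. A ** B - B ** A)\<rparr>"

definition lie_prod :: "'a lie_alg \<Rightarrow> 'b lie_alg \<Rightarrow> ('a \<times> 'b) lie_alg" (infixr "\<times>\<^sub>L" 70) where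
  "A \<times>\<^sub>L B = \<lparr>lie_carrier = lie_carrier A \<times> lie_carrier B,
             lie_br = (\<lambda>(a, b) (a', b'). (lie_br A a a', lie_br B b b'))\<rparr>"

text \<open>\<open>lie_action B A \<rho>\<close>: \<open>\<rho>\<close> is a Lie algebra homomorphism from \<open>B\<close> to the derivations of \<open>A\<close>.\<close>

definition lie_action ::
    "'b::real_vector lie_alg \<Rightarrow> 'a::real_vector lie_alg \<Rightarrow> ('b \<Rightarrow> 'a \<Rightarrow> 'a) \<Rightarrow> bool" where
  "lie_action B A \<rho> \<longleftrightarrow>
     (\<forall>b\<in>lie_carrier B. \<forall>x\<in>lie_carrier A. \<rho> b x \<in> lie_carrier A) \<and>
     (\<forall>b\<in>lie_carrier B. \<forall>x\<in>lie_carrier A. \<forall>y\<in>lie_carrier A. \<forall>r s.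
        \<rho> b (r *\<^sub>R x + s *\<^sub>R y) = r *\<^sub>R \<rho> b x + s *\<^sub>R \<rho> b y) \<and>
     (\<forall>b\<in>lie_carrier B. \<forall>x\<in>lie_carrier A. \<forall>y\<in>lie_carrier A.
        \<rho> b (lie_br A x y) = lie_br A (\<rho> b x) y + lie_br A x (\<rho> b y)) \<and>
     (\<forall>b\<in>lie_carrier B. \<forall>c\<in>lie_carrier B. \<forall>x\<in>lie_carrier A. \<forall>r s.
        \<rho> (r *\<^sub>R b + s *\<^sub>R c) x = r *\<^sub>R \<rho> b x + s *\<^sub>R \<rho> c x) \<and>
     (\<forall>b\<in>lie_carrier B. \<forall>c\<in>lie_carrier B. \<forall>x\<in>lie_carrier A.
        \<rho> (lie_br B b c) x = \<rho> b (\<rho> c x) - \<rho> c (\<rho> b x))"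

text \<open>The semi-direct sum of the ideal \<open>A\<close> (always the first argument) and the complementary
  subalgebra \<open>B\<close> (always the last argument).\<close>

definition lie_semidirect ::
    "'a::real_vector lie_alg \<Rightarrow> ('b \<Rightarrow> 'a \<Rightarrow> 'a) \<Rightarrow> 'b lie_alg \<Rightarrow> ('a \<times> 'b) lie_alg" where
  "lie_semidirect A \<rho> B = \<lparr>lie_carrier = lie_carrier A \<times> lie_carrier B,
     lie_br = (\<lambda>(a, b) (a', b'). (lie_br A a a' + \<rho> b a' - \<rho> b' a, lie_br B b b'))\<rparr>"


section \<open>Vector fields\<close>

instantiation "fun" :: (type, real_vector) real_vector
begin

definition scaleR_fun :: "real \<Rightarrow> ('a \<Rightarrow> 'b) \<Rightarrow> 'a \<Rightarrow> 'b" where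
  "scaleR_fun r f = (\<lambda>x. r *\<^sub>R f x)"

instance
  by standard (simp_all add: scaleR_fun_def fun_eq_iff scaleR_right_distrib scaleR_left_distrib)

end

datatype coord = Ct | Cx | Cy | Cz | Cu | Cv | Cw | Cp | Cq

lemma UNIV_coord: "UNIV = {Ct, Cx, Cy, Cz, Cu, Cv, Cw, Cp, Cq}"
  using coord.exhaust by blast

instance coord :: finite
  by standard (simp add: UNIV_coord)

type_synonym vfield = "real ^ coord \<Rightarrow> real ^ coord"

definition vf_apply :: "vfield \<Rightarrow> (real ^ coord \<Rightarrow> real) \<Rightarrow> real ^ coord \<Rightarrow> real" where
  "vf_apply X f = (\<lambda>m. frechet_derivative f (at m) (X m))"

text \<open>A vector field is determined by its action on the coordinate functions, so its bracket
  \<open>XY - YX\<close> is defined by giving the values on them.\<close>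

definition vf_bracket :: "vfield \<Rightarrow> vfield \<Rightarrow> vfield" where
  "vf_bracket X Y = (\<lambda>m. \<chi> i.
     vf_apply X (vf_apply Y (\<lambda>m'. m' $ i)) m - vf_apply Y (vf_apply X (\<lambda>m'. m' $ i)) m)"

lemma vf_apply_coord: "vf_apply X (\<lambda>m. m $ i) = (\<lambda>m. X m $ i)"
proof
  fix m
  have "frechet_derivative (\<lambda>m::real^coord. m $ i) (at m) = (\<lambda>h. h $ i)"
    by (metis bounded_linear_imp_has_derivative bounded_linear_vec_nth frechet_derivative_at)
  then show "vf_apply X (\<lambda>m. m $ i) m = X m $ i"
    by (simp add: vf_apply_def)
qed

abbreviation vf_partial :: "coord \<Rightarrow> real ^ coord" ("\<partial>") where
  "\<partial> i \<equiv> axis i 1"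

definition X1 :: vfield where "X1 = (\<lambda>m. \<partial> Cx)"
definition X2 :: vfield where "X2 = (\<lambda>m. \<partial> Cy)"
definition X3 :: vfield where "X3 = (\<lambda>m. \<partial> Cz)"
definition X4 :: vfield where "X4 = (\<lambda>m. \<partial> Ct)"
definition X5 :: vfield where "X5 = (\<lambda>m. m$Ct *\<^sub>R \<partial> Cx + \<partial> Cu)"
definition X6 :: vfield where "X6 = (\<lambda>m. m$Ct *\<^sub>R \<partial> Cy + \<partial> Cv)"
definition X7 :: vfield where "X7 = (\<lambda>m. m$Ct *\<^sub>R \<partial> Cz + \<partial> Cw)"
definition X8 :: vfield where
  "X8 = (\<lambda>m. m$Ct *\<^sub>R \<partial> Ct - m$Cu *\<^sub>R \<partial> Cu - m$Cv *\<^sub>R \<partial> Cv - m$Cw *\<^sub>R \<partial> Cw + (2 * m$Cq) *\<^sub>R \<partial> Cq)"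
definition X9 :: vfield where
  "X9 = (\<lambda>m. m$Cx *\<^sub>R \<partial> Cx + m$Cy *\<^sub>R \<partial> Cy + m$Cz *\<^sub>R \<partial> Cz
           + m$Cu *\<^sub>R \<partial> Cu + m$Cv *\<^sub>R \<partial> Cv + m$Cw *\<^sub>R \<partial> Cw - (2 * m$Cq) *\<^sub>R \<partial> Cq)"
definition X10 :: vfield where
  "X10 = (\<lambda>m. m$Cy *\<^sub>R \<partial> Cx - m$Cx *\<^sub>R \<partial> Cy + m$Cv *\<^sub>R \<partial> Cu - m$Cu *\<^sub>R \<partial> Cv)"
definition X11 :: vfield where
  "X11 = (\<lambda>m. - (m$Cz *\<^sub>R \<partial> Cy) + m$Cy *\<^sub>R \<partial> Cz - m$Cw *\<^sub>R \<partial> Cv + m$Cv *\<^sub>R \<partial> Cw)"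
definition X12 :: vfield where
  "X12 = (\<lambda>m. - (m$Cz *\<^sub>R \<partial> Cx) + m$Cx *\<^sub>R \<partial> Cz - m$Cw *\<^sub>R \<partial> Cu + m$Cu *\<^sub>R \<partial> Cw)"
definition X13 :: vfield where "X13 = (\<lambda>m. m$Cq *\<^sub>R \<partial> Cq + m$Cp *\<^sub>R \<partial> Cp)"

definition euler_symmetry_algebra :: "vfield lie_alg" where
  "euler_symmetry_algebra =
     \<lparr>lie_carrier = span {X1, X2, X3, X4, X5, X6, X7, X8, X9, X10, X11, X12, X13},
      lie_br = vf_bracket\<rparr>"

text \<open>Pitfall: since \<open>[X4, X5] = X1\<close>, \<open>[X4, X6] = X2\<close> and \<open>[X4, X7] = X3\<close> are the only nonzero
  brackets among \<open>X1, \<dots>, X7\<close>, the derived algebra of \<open>span {X1, \<dots>, X7}\<close> is \<open>span {X1, X2, X3}\<close>,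
  and it has no abelian complement. In the innermost semi-direct sum of \<open>\<real>\<^sup>3\<close> and \<open>\<real>\<^sup>4\<close> the ideal
  therefore has to be \<open>\<real>\<^sup>4\<close> (for instance \<open>span {X1, X2, X3, X4}\<close>), with \<open>\<real>\<^sup>3\<close> acting on it.\<close>

end

theory Submission
  imports Defs
begin

text \<open>All fields are affine, and for affine fields the bracket at \<open>m\<close> is
  \<open>DY (X m) - DX (Y m)\<close>. The field \<open>X13\<close> is central, and \<open>X8, X9\<close> commute and act
  diagonally on the translations \<open>X1, \<dots>, X4\<close> and the boosts \<open>X5, X6, X7\<close>.
  A rotation \<open>A\<close> acts by the linear field \<open>m \<mapsto> - A m\<close> (simultaneously on positions and on
  velocities); the sign turns the bracket of linear fields into the matrix commutator.
  The parametrisation \<open>euler_field\<close> of the symmetry algebra is the inverse of the isomorphism.\<close>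

section \<open>Lie algebras\<close>

lemma lie_algebraD:
  assumes "lie_algebra L" "x \<in> lie_carrier L" "y \<in> lie_carrier L"
  shows "x + y \<in> lie_carrier L" "x - y \<in> lie_carrier L" "lie_br L x y \<in> lie_carrier L"
  using assms unfolding lie_algebra_def by (auto intro: subspace_add subspace_diff)

lemma lie_algebra_br_self: "lie_algebra L \<Longrightarrow> x \<in> lie_carrier L \<Longrightarrow> lie_br L x x = 0"
  by (simp add: lie_algebra_def)

lemma lie_algebra_br_linear:
  assumes "lie_algebra L" "x \<in> lie_carrier L" "y \<in> lie_carrier L" "z \<in> lie_carrier L"
  shows "lie_br L (a *\<^sub>R x + b *\<^sub>R y) z = a *\<^sub>R lie_br L x z + b *\<^sub>R lie_br L y z"
    "lie_br L z (a *\<^sub>R x + b *\<^sub>R y) = a *\<^sub>R lie_br L z x + b *\<^sub>R lie_br L z y"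
  using assms unfolding lie_algebra_def by blast+

lemma lie_algebra_br_add_diff:
  assumes "lie_algebra L" "x \<in> lie_carrier L" "y \<in> lie_carrier L" "z \<in> lie_carrier L"
  shows "lie_br L z (x + y) = lie_br L z x + lie_br L z y"
    "lie_br L z (x - y) = lie_br L z x - lie_br L z y"
  using lie_algebra_br_linear(2)[OF assms, of 1 1] lie_algebra_br_linear(2)[OF assms, of 1 "-1"]
  by simp_all

text \<open>Polarisation: expanding the vanishing bracket of \<open>x + y\<close> with itself leaves
  the two mixed terms.\<close>

lemma lie_algebra_antisym:
  assumes "lie_algebra L" "x \<in> lie_carrier L" "y \<in> lie_carrier L"
  shows "lie_br L x y = - lie_br L y x"
proof -
  have s: "x + y \<in> lie_carrier L"
    using assms by (rule lie_algebraD)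
  have "lie_br L (x + y) (x + y) = lie_br L x (x + y) + lie_br L y (x + y)"
    using lie_algebra_br_linear(1)[OF assms s, of 1 1] by simp
  then show ?thesis
    using assms s
    by (simp add: lie_algebra_br_add_diff lie_algebra_br_self eq_neg_iff_add_eq_0)
qed

lemma lie_algebra_jacobi:
  assumes "lie_algebra L" "x \<in> lie_carrier L" "y \<in> lie_carrier L" "z \<in> lie_carrier L"
  shows "lie_br L x (lie_br L y z) + lie_br L y (lie_br L z x) + lie_br L z (lie_br L x y) = 0"
  using assms unfolding lie_algebra_def by blast

section \<open>The building blocks: abelian algebras and skew matrices\<close>

lemma lie_algebra_abelian: "lie_algebra abelian_lie"
  by (simp add: lie_algebra_def abelian_lie_def)

lemma matrix_add_rdistrib: "(A + B) ** C = A ** C + B ** (C :: real ^ 'k ^ 'm)"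
  by (simp add: matrix_matrix_mult_def vec_eq_iff sum.distrib distrib_right)

lemma matrix_diff_ldistrib: "A ** (B - C) = A ** B - A ** (C :: real ^ 'k ^ 'm)"
  by (simp add: matrix_matrix_mult_def vec_eq_iff sum_subtractf right_diff_distrib)

lemma matrix_diff_rdistrib: "(A - B) ** C = A ** C - B ** (C :: real ^ 'k ^ 'm)"
  by (simp add: matrix_matrix_mult_def vec_eq_iff sum_subtractf left_diff_distrib)

text \<open>Bilinearity and the Jacobi identity hold for commutators of arbitrary matrices. Skew
  symmetry enters in closure: transposition reverses products and the signs cancel in pairs, so
  \<open>A ** B - B ** A\<close> goes to \<open>B ** A - A ** B\<close>.\<close>

lemma lie_algebra_so3: "lie_algebra so3_lie"
proof -
  have sub: "subspace {A :: real ^ 3 ^ 3. transpose A = - A}"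
  proof (rule subspaceI)
    show "(0 :: real ^ 3 ^ 3) \<in> {A. transpose A = - A}"
      by (simp add: transpose_def vec_eq_iff)
    show "A + B \<in> {A. transpose A = - A}"
      if "A \<in> {A. transpose A = - A}" "B \<in> {A. transpose A = - A}" for A B :: "real ^ 3 ^ 3"
    proof -
      have "transpose (A + B) = transpose A + transpose B"
        by (simp add: transpose_def vec_eq_iff)
      then show ?thesis
        using that by simp
    qed
    show "c *\<^sub>R A \<in> {A. transpose A = - A}"
      if "A \<in> {A. transpose A = - A}" for c and A :: "real ^ 3 ^ 3"
      using that by (simp add: transpose_scalar)
  qed
  have closed: "transpose (A ** B - B ** A) = - (A ** B - B ** A)"
    if "transpose A = - A" "transpose B = - B" for A B :: "real ^ 3 ^ 3"
  proof -
    have "transpose (A ** B - B ** A) = transpose (A ** B) - transpose (B ** A)"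
      by (simp add: transpose_def vec_eq_iff)
    also have "\<dots> = (- B) ** (- A) - (- A) ** (- B)"
      using that by (simp add: matrix_transpose_mul)
    also have "\<dots> = - (A ** B - B ** A)"
      by (simp add: vec_eq_iff matrix_matrix_mult_def)
    finally show ?thesis .
  qed
  have lin: "(a *\<^sub>R A + b *\<^sub>R B) ** C - C ** (a *\<^sub>R A + b *\<^sub>R B)
      = a *\<^sub>R (A ** C - C ** A) + b *\<^sub>R (B ** C - C ** B)"
    "C ** (a *\<^sub>R A + b *\<^sub>R B) - (a *\<^sub>R A + b *\<^sub>R B) ** C
      = a *\<^sub>R (C ** A - A ** C) + b *\<^sub>R (C ** B - B ** C)"
    for A B C :: "real ^ 3 ^ 3" and a b
    by (simp_all add: matrix_add_ldistrib matrix_add_rdistrib matrix_scalar_ac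
        algebra_simps flip: scalar_matrix_assoc)
  have jacobi: "A ** (B ** C - C ** B) - (B ** C - C ** B) ** A
      + (B ** (C ** A - A ** C) - (C ** A - A ** C) ** B)
      + (C ** (A ** B - B ** A) - (A ** B - B ** A) ** C) = 0" for A B C :: "real ^ 3 ^ 3"
    by (simp add: matrix_diff_ldistrib matrix_diff_rdistrib matrix_mul_assoc)
  show ?thesis
    unfolding lie_algebra_def so3_lie_def lie_alg.simps
    using sub closed lin jacobi by simp
qed

section \<open>Direct products, semi-direct sums and isomorphisms\<close>

lemma lie_algebra_prod:
  assumes A: "lie_algebra A" and B: "lie_algebra B"
  shows "lie_algebra (A \<times>\<^sub>L B)"
  using assms subspace_Times[of "lie_carrier A" "lie_carrier B"]
  unfolding lie_algebra_def lie_prod_def by (auto simp: zero_prod_def)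

lemma lie_action_closed:
  assumes "lie_action B A \<rho>" "b \<in> lie_carrier B" "x \<in> lie_carrier A"
  shows "\<rho> b x \<in> lie_carrier A"
  using assms unfolding lie_action_def by blast

lemma lie_actionD:
  assumes "lie_action B A \<rho>" "b \<in> lie_carrier B" "x \<in> lie_carrier A" "y \<in> lie_carrier A"
  shows "\<rho> b (r *\<^sub>R x + s *\<^sub>R y) = r *\<^sub>R \<rho> b x + s *\<^sub>R \<rho> b y"
    "\<rho> b (lie_br A x y) = lie_br A (\<rho> b x) y + lie_br A x (\<rho> b y)"
  using assms unfolding lie_action_def by blast+

lemma lie_actionD':
  assumes "lie_action B A \<rho>" "b \<in> lie_carrier B" "c \<in> lie_carrier B" "x \<in> lie_carrier A"
  shows "\<rho> (r *\<^sub>R b + s *\<^sub>R c) x = r *\<^sub>R \<rho> b x + s *\<^sub>R \<rho> c x"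
    "\<rho> (lie_br B b c) x = \<rho> b (\<rho> c x) - \<rho> c (\<rho> b x)"
  using assms unfolding lie_action_def by blast+

lemma lie_action_add_diff:
  assumes "lie_action B A \<rho>" "b \<in> lie_carrier B" "x \<in> lie_carrier A" "y \<in> lie_carrier A"
  shows "\<rho> b (x + y) = \<rho> b x + \<rho> b y" "\<rho> b (x - y) = \<rho> b x - \<rho> b y"
  using lie_actionD(1)[OF assms, of 1 1] lie_actionD(1)[OF assms, of 1 "-1"] by simp_all

lemma lie_algebra_semidirect:
  assumes A: "lie_algebra A" and B: "lie_algebra B" and \<rho>: "lie_action B A \<rho>"
  shows "lie_algebra (lie_semidirect A \<rho> B)"
proof -
  \<comment> \<open>First component of the Jacobi identity for \<open>(x, b)\<close>,
    \<open>(y, c)\<close>, \<open>(z, d)\<close>. The terms with two actions cancel by the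
    homomorphism law.\<close>
  have jacobi: "lie_br A x (lie_br A y z + \<rho> c z - \<rho> d y)
        + \<rho> b (lie_br A y z + \<rho> c z - \<rho> d y) - \<rho> (lie_br B c d) x
      + (lie_br A y (lie_br A z x + \<rho> d x - \<rho> b z)
        + \<rho> c (lie_br A z x + \<rho> d x - \<rho> b z) - \<rho> (lie_br B d b) y)
      + (lie_br A z (lie_br A x y + \<rho> b y - \<rho> c x)
        + \<rho> d (lie_br A x y + \<rho> b y - \<rho> c x) - \<rho> (lie_br B b c) z) = 0"
    if "x \<in> lie_carrier A" "y \<in> lie_carrier A" "z \<in> lie_carrier A"
      "b \<in> lie_carrier B" "c \<in> lie_carrier B" "d \<in> lie_carrier B" for x y z b c d
  proof -
    note [simp] = that A B lie_algebraD lie_algebra_br_add_diff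
      lie_action_closed[OF \<rho>] lie_actionD(2)[OF \<rho>] lie_actionD'(2)[OF \<rho>] lie_action_add_diff[OF \<rho>]
    \<comment> \<open>The derivation law yields six brackets containing one action. Three cancel
      against cross terms as they stand, the other three only after their arguments are
      swapped.\<close>
    have anti: "lie_br A (\<rho> e u) v = - lie_br A v (\<rho> e u)"
      if "e \<in> lie_carrier B" "u \<in> lie_carrier A" "v \<in> lie_carrier A" for e u v
      using that A by (intro lie_algebra_antisym lie_action_closed[OF \<rho>])
    have "lie_br A (\<rho> b y) z = - lie_br A z (\<rho> b y)"
      "lie_br A (\<rho> c z) x = - lie_br A x (\<rho> c z)"
      "lie_br A (\<rho> d x) y = - lie_br A y (\<rho> d x)"
      by (rule anti; fact that)+
    moreover have "lie_br A x (lie_br A y z) + lie_br A y (lie_br A z x)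
        + lie_br A z (lie_br A x y) = 0"
      by (simp add: lie_algebra_jacobi)
    ultimately show ?thesis
      by (simp add: algebra_simps)
  qed
  have linear: "lie_br A (r *\<^sub>R x + s *\<^sub>R y) z + \<rho> (r *\<^sub>R b + s *\<^sub>R c) z - \<rho> d (r *\<^sub>R x + s *\<^sub>R y)
        = r *\<^sub>R (lie_br A x z + \<rho> b z - \<rho> d x) + s *\<^sub>R (lie_br A y z + \<rho> c z - \<rho> d y)"
      "lie_br A z (r *\<^sub>R x + s *\<^sub>R y) + \<rho> d (r *\<^sub>R x + s *\<^sub>R y) - \<rho> (r *\<^sub>R b + s *\<^sub>R c) z
        = r *\<^sub>R (lie_br A z x + \<rho> d x - \<rho> b z) + s *\<^sub>R (lie_br A z y + \<rho> d y - \<rho> c z)"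
    if "x \<in> lie_carrier A" "y \<in> lie_carrier A" "z \<in> lie_carrier A"
      "b \<in> lie_carrier B" "c \<in> lie_carrier B" "d \<in> lie_carrier B" for x y z b c d r s
    using that
    by (simp_all add: lie_algebra_br_linear[OF A] lie_actionD(1)[OF \<rho>] lie_actionD'(1)[OF \<rho>]
        algebra_simps)
  have "subspace (lie_carrier A \<times> lie_carrier B)"
    using A B by (auto simp: lie_algebra_def intro: subspace_Times)
  then show ?thesis
    unfolding lie_algebra_def[of "lie_semidirect A \<rho> B"]
    using A B \<rho>
    by (simp add: lie_semidirect_def lie_algebraD lie_algebra_br_self
        lie_algebra_br_linear[OF B] lie_action_closed linear jacobi lie_algebra_jacobi zero_prod_def split_beta mem_Times_iff)
qed

text \<open>The map runs from the model \<open>M\<close> to \<open>L\<close>, the direction in which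
  a formula is available; the isomorphism is its inverse. The Jacobi identity of \<open>L\<close> is
  transported from \<open>M\<close>.\<close>

lemma lie_isomorphicI:
  fixes \<psi> :: "'b::real_vector \<Rightarrow> 'a::real_vector"
  assumes M: "lie_algebra M" and lin: "linear \<psi>" and inj: "inj_on \<psi> (lie_carrier M)"
    and img: "\<psi> ` lie_carrier M = lie_carrier L"
    and br: "\<And>x y. x \<in> lie_carrier M \<Longrightarrow> y \<in> lie_carrier M \<Longrightarrow>
      lie_br L (\<psi> x) (\<psi> y) = \<psi> (lie_br M x y)"
  shows "L \<cong>\<^sub>L M"
proof -
  let ?\<phi> = "inv_into (lie_carrier M) \<psi>"
  have lcomb: "a *\<^sub>R \<psi> x + b *\<^sub>R \<psi> y = \<psi> (a *\<^sub>R x + b *\<^sub>R y)" for a b x y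
    using lin by (simp add: linear_add linear_scale)
  have sub: "subspace (lie_carrier M)"
    using M by (simp add: lie_algebra_def)
  have mem: "a *\<^sub>R x + b *\<^sub>R y \<in> lie_carrier M"
    if "x \<in> lie_carrier M" "y \<in> lie_carrier M" for a b x y
    using that sub by (simp add: subspace_add subspace_scale)
  have brM: "lie_br M x y \<in> lie_carrier M" if "x \<in> lie_carrier M" "y \<in> lie_carrier M" for x y
    using M that by (rule lie_algebraD)
  have inv: "?\<phi> (\<psi> x) = x" if "x \<in> lie_carrier M" for x
    using inj that by simp
  have "subspace (lie_carrier L)"
    using linear_subspace_image[OF lin sub] by (simp add: img)
  \<comment> \<open>Quantifiers over the carrier of \<open>L\<close> become quantifiers over
    \<open>lie_carrier M\<close>, and each axiom is the image under \<psi> of the one for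
    \<open>M\<close>.\<close>
  then have "lie_algebra L"
    unfolding lie_algebra_def img[symmetric] ball_simps
    using M by (auto simp: br brM lcomb mem lie_algebra_br_linear lie_algebra_br_self linear_0[OF lin]
        lie_algebra_jacobi simp flip: linear_add[OF lin])
  moreover have "bij_betw ?\<phi> (lie_carrier L) (lie_carrier M)"
    using inj img by (intro bij_betw_inv_into) (simp add: bij_betw_def)
  ultimately show ?thesis
    unfolding lie_isomorphic_def
    using M by (intro conjI exI[of _ ?\<phi>]) (auto simp: img[symmetric] br brM lcomb mem inv)
qed


section \<open>The symmetry algebra\<close>

text \<open>Affinity is encoded as linearity after subtracting the value at the origin. This linear
  part is the derivative at every point, and by \<open>vf_apply_coord\<close> the inner applications
  in the bracket are the components of the fields.\<close>

lemma vf_bracket_affine: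
  assumes X: "linear (\<lambda>m. X m - X 0)" and Y: "linear (\<lambda>m. Y m - Y 0)"
  shows "vf_bracket X Y m = (Y (X m) - Y 0) - (X (Y m) - X 0)"
proof -
  have apply_affine: "vf_apply V (\<lambda>m. W m $ i) m = (W (V m) - W 0) $ i"
    if "linear (\<lambda>m. W m - W 0)" for V W :: vfield and i
  proof -
    have "((\<lambda>m. (W m - W 0) + W 0) has_derivative (\<lambda>h. W h - W 0)) (at m)"
      using has_derivative_add[OF linear_imp_has_derivative[OF that] has_derivative_const[of "W 0"]]
      by simp
    then have "((\<lambda>m. W m $ i) has_derivative (\<lambda>h. (W h - W 0) $ i)) (at m)"
      by (auto dest: bounded_linear.has_derivative[OF bounded_linear_vec_nth])
    from frechet_derivative_at[OF this, symmetric] show ?thesis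
      by (simp add: vf_apply_def)
  qed
  show ?thesis
    by (simp add: vf_bracket_def vf_apply_coord apply_affine[OF X] apply_affine[OF Y] vec_eq_iff)
qed

section \<open>The model and its three actions\<close>

definition spatial :: "real ^ 4 \<Rightarrow> real ^ 3" where
  "spatial a = vector [a$1, a$2, a$3]"

definition spacetime :: "real ^ 3 \<Rightarrow> real \<Rightarrow> real ^ 4" where
  "spacetime v \<tau> = vector [v$1, v$2, v$3, \<tau>]"

text \<open>Encodes \<open>[X5, X4] = - X1\<close> and its analogues for \<open>X6\<close> and
  \<open>X7\<close>; \<open>a$4\<close> is the coefficient of \<open>X4\<close>.\<close>

definition boost_action :: "real ^ 3 \<Rightarrow> real ^ 4 \<Rightarrow> real ^ 4" where
  "boost_action b a = spacetime (- (a$4) *\<^sub>R b) 0"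

text \<open>Weights under \<open>X8\<close> and \<open>X9\<close>, the two entries of
  \<open>d\<close>: spatial translations 0 and -1, time translation -1 and 0, boosts 1 and
  -1.\<close>

definition dilation_action ::
    "real ^ 2 \<Rightarrow> (real ^ 4) \<times> (real ^ 3) \<Rightarrow> (real ^ 4) \<times> (real ^ 3)" where
  "dilation_action d = (\<lambda>(a, b). (spacetime (- (d$2) *\<^sub>R spatial a) (- (d$1) * a$4), (d$1 - d$2) *\<^sub>R b))"

text \<open>The bracket of the field \<open>- A m\<close> with a constant field \<open>a\<close> is
  \<open>A a\<close>, hence the positive sign. Rotations commute with the time translation and the
  dilations, hence the zeros.\<close>

definition rotation_action ::
    "real ^ 3 ^ 3 \<Rightarrow> ((real ^ 4) \<times> (real ^ 3)) \<times> (real ^ 2) \<Rightarrow> ((real ^ 4) \<times> (real ^ 3)) \<times> (real ^ 2)" where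
  "rotation_action A = (\<lambda>((a, b), d). ((spacetime (A *v spatial a) 0, A *v b), 0))"

lemma vector_4:
  fixes x y z w :: "'a::zero"
  shows "(vector [x, y, z, w] :: 'a ^ 4) $ 1 = x" "(vector [x, y, z, w] :: 'a ^ 4) $ 2 = y"
    "(vector [x, y, z, w] :: 'a ^ 4) $ 3 = z" "(vector [x, y, z, w] :: 'a ^ 4) $ 4 = w"
  by (simp_all add: vector_def)

lemmas vec_components = vec_eq_iff forall_4 forall_3 forall_2 spatial_def spacetime_def
  vector_3 vector_4 matrix_vector_mult_def matrix_matrix_mult_def sum_3

text \<open>A boost maps into the vectors with zero fourth entry, which every boost annihilates; so
  any two boosts act by commuting maps.\<close>

lemma lie_action_boost: "lie_action abelian_lie abelian_lie boost_action"
  unfolding lie_action_def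
  by (simp add: abelian_lie_def boost_action_def vec_components algebra_simps)

abbreviation galilei :: "((real ^ 4) \<times> (real ^ 3)) lie_alg" where
  "galilei \<equiv> lie_semidirect abelian_lie boost_action abelian_lie"

text \<open>The derivation law is additivity of weights: a time translation and a boost bracket to a
  spatial translation, and \<open>- d$1 + (d$1 - d$2) = - d$2\<close>.\<close>

lemma lie_action_dilation: "lie_action abelian_lie galilei dilation_action"
  unfolding lie_action_def
  by (simp add: abelian_lie_def lie_semidirect_def boost_action_def dilation_action_def
      vec_components algebra_simps)

abbreviation galilei_dilation :: "(((real ^ 4) \<times> (real ^ 3)) \<times> (real ^ 2)) lie_alg" where
  "galilei_dilation \<equiv> lie_semidirect galilei dilation_action abelian_lie"

text \<open>In the brackets of \<open>galilei_dilation\<close>, spatial vectors occur only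
  multiplied by scalars that rotations leave alone (\<open>a$4\<close> and the entries of
  \<open>d\<close>), so the linear map \<open>A\<close> passes through.\<close>

lemma lie_action_rotation: "lie_action so3_lie galilei_dilation rotation_action"
  unfolding lie_action_def
  by (simp add: so3_lie_def abelian_lie_def lie_semidirect_def boost_action_def
      dilation_action_def rotation_action_def vec_components zero_prod_def algebra_simps)

abbreviation euler_model ::
    "(real \<times> (((real ^ 4) \<times> (real ^ 3)) \<times> (real ^ 2)) \<times> (real ^ 3 ^ 3)) lie_alg" where
  "euler_model \<equiv> abelian_lie \<times>\<^sub>L lie_semidirect galilei_dilation rotation_action so3_lie"

lemma lie_algebra_euler_model: "lie_algebra euler_model"
  by (intro lie_algebra_prod lie_algebra_semidirect lie_algebra_abelian lie_algebra_so3
      lie_action_boost lie_action_dilation lie_action_rotation)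

section \<open>The parametrisation by affine fields\<close>

definition position :: "real ^ coord \<Rightarrow> real ^ 3" where
  "position m = vector [m$Cx, m$Cy, m$Cz]"

definition velocity :: "real ^ coord \<Rightarrow> real ^ 3" where
  "velocity m = vector [m$Cu, m$Cv, m$Cw]"

definition coord_vec :: "real \<Rightarrow> real ^ 3 \<Rightarrow> real ^ 3 \<Rightarrow> real \<Rightarrow> real \<Rightarrow> real ^ coord" where
  "coord_vec t r v p q = (\<chi> i. case i of Ct \<Rightarrow> t | Cx \<Rightarrow> r$1 | Cy \<Rightarrow> r$2 | Cz \<Rightarrow> r$3
     | Cu \<Rightarrow> v$1 | Cv \<Rightarrow> v$2 | Cw \<Rightarrow> v$3 | Cp \<Rightarrow> p | Cq \<Rightarrow> q)"

definition euler_field ::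
    "real \<times> (((real ^ 4) \<times> (real ^ 3)) \<times> (real ^ 2)) \<times> (real ^ 3 ^ 3) \<Rightarrow> vfield" where
  "euler_field = (\<lambda>(s, ((a, b), d), A) m. coord_vec
     (a$4 + d$1 * m$Ct)
     (spatial a + m$Ct *\<^sub>R b + d$2 *\<^sub>R position m - A *v position m)
     (b + (d$2 - d$1) *\<^sub>R velocity m - A *v velocity m)
     (s * m$Cp)
     ((s + 2 * d$1 - 2 * d$2) * m$Cq))"

lemma forall_coord:
  "(\<forall>i. P i) \<longleftrightarrow> P Ct \<and> P Cx \<and> P Cy \<and> P Cz \<and> P Cu \<and> P Cv \<and> P Cw \<and> P Cp \<and> P Cq"
  by (metis coord.exhaust)

lemmas field_components = euler_field_def coord_vec_def position_def velocity_def forall_coord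
  vec_components

lemma linear_euler_field: "linear euler_field"
  by (rule linearI)
    (auto simp: fun_eq_iff scaleR_fun_def field_components algebra_simps)

lemma affine_euler_field: "linear (\<lambda>m. euler_field c m - euler_field c 0)"
  by (cases c, rule linearI) (auto simp: field_components algebra_simps)

text \<open>By the affine bracket formula this is a polynomial identity in the coordinates and the
  parameters, which checks all structure constants at once.\<close>

lemma euler_field_bracket:
  "vf_bracket (euler_field c) (euler_field c') = euler_field (lie_br euler_model c c')"
proof
  fix m
  show "vf_bracket (euler_field c) (euler_field c') m = euler_field (lie_br euler_model c c') m"
    unfolding vf_bracket_affine[OF affine_euler_field affine_euler_field]
    by (cases c, cases c')
      (auto simp: lie_prod_def lie_semidirect_def abelian_lie_def so3_lie_def boost_action_def dilation_action_def
        rotation_action_def field_components algebra_simps)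
qed

lemma inj_euler_field: "inj euler_field"
proof (rule linear_injective_0[OF linear_euler_field, THEN iffD2], intro allI impI)
  fix c
  assume zero: "euler_field c = 0"
  obtain s a b d A where c: "c = (s, ((a, b), d), A)"
    by (metis surj_pair)
  have eq: "euler_field (s, ((a, b), d), A) m $ i = 0" for m i
    using zero by (simp add: c)
  note [simp] = euler_field_def coord_vec_def position_def velocity_def vec_components axis_def
  \<comment> \<open>At the origin only the translation and boost coefficients survive.\<close>
  have a: "a$4 = 0" "a$1 = 0" "a$2 = 0" "a$3 = 0"
    using eq[of 0 Ct] eq[of 0 Cx] eq[of 0 Cy] eq[of 0 Cz] by simp_all
  have b: "b$1 = 0" "b$2 = 0" "b$3 = 0"
    using eq[of 0 Cu] eq[of 0 Cv] eq[of 0 Cw] by simp_all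
  have s: "s = 0"
    using eq[of "axis Cp 1" Cp] by simp
  have d1: "d$1 = 0"
    using eq[of "axis Ct 1" Ct] a by simp
  \<comment> \<open>The \<open>q\<close> component is used because in the position components
    \<open>d$2\<close> is mixed with the diagonal of the arbitrary matrix \<open>A\<close>.\<close>
  have d2: "d$2 = 0"
    using eq[of "axis Cq 1" Cq] s d1 by simp
  have "A$1$1 = 0" "A$2$1 = 0" "A$3$1 = 0"
    using eq[of "axis Cx 1" Cx] eq[of "axis Cx 1" Cy] eq[of "axis Cx 1" Cz] a d2 by simp_all
  moreover have "A$1$2 = 0" "A$2$2 = 0" "A$3$2 = 0"
    using eq[of "axis Cy 1" Cx] eq[of "axis Cy 1" Cy] eq[of "axis Cy 1" Cz] a d2 by simp_all
  moreover have "A$1$3 = 0" "A$2$3 = 0" "A$3$3 = 0"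
    using eq[of "axis Cz 1" Cx] eq[of "axis Cz 1" Cy] eq[of "axis Cz 1" Cz] a d2 by simp_all
  ultimately show "c = 0"
    using a b s d1 d2 by (simp add: c zero_prod_def)
qed

section \<open>The image as the span of the generators\<close>

lemma skew_3:
  fixes A :: "real ^ 3 ^ 3"
  shows "transpose A = - A \<longleftrightarrow> A$1$1 = 0 \<and> A$2$2 = 0 \<and> A$3$3 = 0 \<and>
    A$2$1 = - A$1$2 \<and> A$3$1 = - A$1$3 \<and> A$3$2 = - A$2$3"
proof -
  have "transpose A = - A \<longleftrightarrow> (\<forall>i j. A$j$i = - A$i$j)"
    by (simp add: transpose_def vec_eq_iff)
  then show ?thesis
    unfolding forall_3 by (rule HOL.trans) (rule iffI; elim conjE; intro conjI; linarith)
qed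

lemmas generator_defs = X1_def X2_def X3_def X4_def X5_def X6_def X7_def X8_def X9_def X10_def
  X11_def X12_def X13_def

text \<open>A skew matrix is determined by its entries above the diagonal. \<open>X10\<close> is the
  field \<open>- A m\<close> with \<open>A$1$2 = -1\<close>, hence its minus sign, while
  \<open>X11\<close> and \<open>X12\<close> belong to \<open>A$2$3 = 1\<close> and
  \<open>A$1$3 = 1\<close>.\<close>

lemma euler_field_expansion:
  assumes "transpose A = - A"
  shows "euler_field (s, ((a, b), d), A) =
    a$1 *\<^sub>R X1 + a$2 *\<^sub>R X2 + a$3 *\<^sub>R X3 + a$4 *\<^sub>R X4 + b$1 *\<^sub>R X5 + b$2 *\<^sub>R X6 + b$3 *\<^sub>R X7
    + d$1 *\<^sub>R X8 + d$2 *\<^sub>R X9 + (- A$1$2) *\<^sub>R X10 + A$2$3 *\<^sub>R X11 + A$1$3 *\<^sub>R X12 + s *\<^sub>R X13"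
    (is "?f = ?g")
proof
  fix m
  show "?f m = ?g m"
    using assms[unfolded skew_3] unfolding vec_eq_iff forall_coord
    by (intro conjI) (simp_all add: scaleR_fun_def generator_defs euler_field_def coord_vec_def
        position_def velocity_def spatial_def matrix_vector_mult_def sum_3 axis_def algebra_simps)
qed

lemma euler_field_image:
  "euler_field ` lie_carrier euler_model = lie_carrier euler_symmetry_algebra"
proof -
  let ?G = "{X1, X2, X3, X4, X5, X6, X7, X8, X9, X10, X11, X12, X13}"
  let ?I = "euler_field ` lie_carrier euler_model"
  have carrier: "(s, e, A) \<in> lie_carrier euler_model \<longleftrightarrow> transpose A = - A" for s e A
    by (cases e) (auto simp: lie_prod_def lie_semidirect_def abelian_lie_def so3_lie_def)
  have "?I \<subseteq> span ?G"
  proof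
    fix X
    assume "X \<in> ?I"
    then obtain c where c: "c \<in> lie_carrier euler_model" "X = euler_field c"
      by blast
    moreover obtain s a b d A where "c = (s, ((a, b), d), A)"
      by (metis surj_pair)
    ultimately have "transpose A = - A" "X = euler_field (s, ((a, b), d), A)"
      using carrier by simp_all
    then show "X \<in> span ?G"
      by (simp only: euler_field_expansion) (intro span_add span_scale span_base; simp)
  qed
  moreover have "span ?G \<subseteq> ?I"
  proof (rule span_minimal)
    show "subspace ?I"
      using lie_algebra_euler_model
      by (auto simp: lie_algebra_def intro: linear_subspace_image[OF linear_euler_field])
    have mem: "X \<in> ?I" if "transpose A = - A" "X = euler_field (s, ((a, b), d), A)" for X s a b d A
      using that carrier by blast
    \<comment> \<open>Any three entries above the diagonal extend to a skew matrix, so all thirteen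
      coefficients can be prescribed freely.\<close>
    let ?R = "\<lambda>\<alpha> \<beta> \<delta>. vector [vector [0, \<alpha>, \<beta>], vector [- \<alpha>, 0, \<delta>], vector [- \<beta>, - \<delta>, 0]] :: real ^ 3 ^ 3"
    have gen: "a$1 *\<^sub>R X1 + a$2 *\<^sub>R X2 + a$3 *\<^sub>R X3 + a$4 *\<^sub>R X4 + b$1 *\<^sub>R X5 + b$2 *\<^sub>R X6 + b$3 *\<^sub>R X7
        + d$1 *\<^sub>R X8 + d$2 *\<^sub>R X9 + (- \<alpha>) *\<^sub>R X10 + \<delta> *\<^sub>R X11 + \<beta> *\<^sub>R X12 + s *\<^sub>R X13 \<in> ?I"
      for a :: "real ^ 4" and b :: "real ^ 3" and d :: "real ^ 2" and \<alpha> \<beta> \<delta> s :: real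
    proof (rule mem)
      show R: "transpose (?R \<alpha> \<beta> \<delta>) = - ?R \<alpha> \<beta> \<delta>"
        by (simp add: skew_3 vector_3)
      show "a$1 *\<^sub>R X1 + a$2 *\<^sub>R X2 + a$3 *\<^sub>R X3 + a$4 *\<^sub>R X4 + b$1 *\<^sub>R X5 + b$2 *\<^sub>R X6 + b$3 *\<^sub>R X7
        + d$1 *\<^sub>R X8 + d$2 *\<^sub>R X9 + (- \<alpha>) *\<^sub>R X10 + \<delta> *\<^sub>R X11 + \<beta> *\<^sub>R X12 + s *\<^sub>R X13
        = euler_field (s, ((a, b), d), ?R \<alpha> \<beta> \<delta>)"
        by (simp add: euler_field_expansion[OF R] vector_3)
    qed
    show "?G \<subseteq> ?I"
      \<comment> \<open>Each instance isolates one generator; the -1 compensates the sign in front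
        of \<open>X10\<close>.\<close>
      using gen[of "axis 1 1" 0 0 0 0 0 0] gen[of "axis 2 1" 0 0 0 0 0 0]
        gen[of "axis 3 1" 0 0 0 0 0 0] gen[of "axis 4 1" 0 0 0 0 0 0]
        gen[of 0 "axis 1 1" 0 0 0 0 0] gen[of 0 "axis 2 1" 0 0 0 0 0]
        gen[of 0 "axis 3 1" 0 0 0 0 0] gen[of 0 0 "axis 1 1" 0 0 0 0]
        gen[of 0 0 "axis 2 1" 0 0 0 0] gen[of 0 0 0 "-1" 0 0 0]
        gen[of 0 0 0 0 1 0 0] gen[of 0 0 0 0 0 1 0] gen[of 0 0 0 0 0 0 1]
      by (simp add: axis_def)
  qed
  ultimately show ?thesis
    by (simp add: euler_symmetry_algebra_def)
qed

theorem theorem4: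
  shows "\<exists>(\<rho>\<^sub>1 :: real ^ 3 \<Rightarrow> real ^ 4 \<Rightarrow> real ^ 4)
          (\<rho>\<^sub>2 :: real ^ 2 \<Rightarrow> (real ^ 4) \<times> (real ^ 3) \<Rightarrow> (real ^ 4) \<times> (real ^ 3))
          (\<rho>\<^sub>3 :: real ^ 3 ^ 3 \<Rightarrow> ((real ^ 4) \<times> (real ^ 3)) \<times> (real ^ 2)
                          \<Rightarrow> ((real ^ 4) \<times> (real ^ 3)) \<times> (real ^ 2)).
           lie_action abelian_lie abelian_lie \<rho>\<^sub>1 \<and>
           lie_action abelian_lie (lie_semidirect abelian_lie \<rho>\<^sub>1 abelian_lie) \<rho>\<^sub>2 \<and>
           lie_action so3_lie
             (lie_semidirect (lie_semidirect abelian_lie \<rho>\<^sub>1 abelian_lie) \<rho>\<^sub>2 abelian_lie) \<rho>\<^sub>3 \<and>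
           euler_symmetry_algebra \<cong>\<^sub>L
             (abelian_lie :: real lie_alg) \<times>\<^sub>L
               lie_semidirect
                 (lie_semidirect
                    (lie_semidirect (abelian_lie :: (real ^ 4) lie_alg) \<rho>\<^sub>1
                       (abelian_lie :: (real ^ 3) lie_alg))
                    \<rho>\<^sub>2 (abelian_lie :: (real ^ 2) lie_alg))
                 \<rho>\<^sub>3 so3_lie"
proof (intro exI conjI)
  \<comment> \<open>Taking this conjunct first fixes the three existential witnesses by unification
    with the actions inside \<open>euler_model\<close>.\<close>
  show "euler_symmetry_algebra \<cong>\<^sub>L euler_model"
  proof (rule lie_isomorphicI[OF lie_algebra_euler_model linear_euler_field _ euler_field_image])
    show "inj_on euler_field (lie_carrier euler_model)"
      using inj_euler_field by (rule inj_on_subset) simp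
    show "lie_br euler_symmetry_algebra (euler_field x) (euler_field y)
        = euler_field (lie_br euler_model x y)" for x y
      by (simp add: euler_symmetry_algebra_def euler_field_bracket)
  qed
qed (rule lie_action_boost lie_action_dilation lie_action_rotation)+

end
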